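(* Up to isomorphism, there is a unique 2-cell embedding of $K_{3,3}$ on the double torus.
   Context: The double torus is the orientable surface of genus 2. A 2-cell embedding (every face homeomorphic to an open disc) of a graph $G$ on an orientable surface is described by a rotation system: for each vertex a cyclic ordering of its incident edges. Two embeddings are isomorphic if some permutation of the vertices and edges of $G$ (preserving incidence) transforms one rotation system into the other. *)

theory Defs
  imports "HOL-Combinatorics.Combinatorics"
begin

definition simple_graph :: "'v set \<Rightarrow> 'v set set \<Rightarrow> bool" where
  "simple_graph V E \<longleftrightarrow> finite V \<and> (\<forall>e\<in>E. e \<subseteq> V \<and> card e = 2)"

definition connected_graph :: "'v set \<Rightarrow> 'v set set \<Rightarrow> bool" where
  "connected_graph V E \<longleftrightarrow>
     V \<noteq> {} \<and> (\<forall>u\<in>V. \<forall>v\<in>V. (u, v) \<in> {(x, y). {x, y} \<in> E}\<^sup>*)"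

definition complete_bipartite :: "nat \<Rightarrow> nat \<Rightarrow> 'v set \<Rightarrow> 'v set set \<Rightarrow> bool" where
  "complete_bipartite m n V E \<longleftrightarrow>
     (\<exists>A B. finite A \<and> finite B \<and> card A = m \<and> card B = n \<and> A \<inter> B = {} \<and>
        V = A \<union> B \<and> E = {{a, b} | a b. a \<in> A \<and> b \<in> B})"

definition incident_edges :: "'v set set \<Rightarrow> 'v \<Rightarrow> 'v set set" where
  "incident_edges E v = {e \<in> E. v \<in> e}"

text \<open>
  A cyclic ordering of the edges at \<open>v\<close> is given by its successor function \<open>\<rho> v\<close>: a permutation
  of the incident edges that consists of a single cycle. At an isolated vertex there is
  nothing to order.
\<close>
definition rotation_system :: "'v set \<Rightarrow> 'v set set \<Rightarrow> ('v \<Rightarrow> 'v set \<Rightarrow> 'v set) \<Rightarrow> bool" where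
  "rotation_system V E \<rho> \<longleftrightarrow>
     (\<forall>v\<in>V. \<rho> v permutes incident_edges E v \<and>
        (incident_edges E v \<noteq> {} \<longrightarrow> cyclic_on (\<rho> v) (incident_edges E v)))"

text \<open>
  The dart \<open>(v, e)\<close> stands for the edge \<open>e\<close> traversed starting from its end \<open>v\<close>. Face tracing
  runs along \<open>e\<close> to the other end \<open>w\<close> and leaves \<open>w\<close> along the successor of \<open>e\<close> in the rotation
  at \<open>w\<close>. The orbits are the boundary walks of the faces.
\<close>
definition darts :: "'v set set \<Rightarrow> ('v \<times> 'v set) set" where
  "darts E = {(v, e). e \<in> E \<and> v \<in> e}"

definition other_end :: "'v set \<Rightarrow> 'v \<Rightarrow> 'v" where
  "other_end e v = the_elem (e - {v})"

definition face_step :: "('v \<Rightarrow> 'v set \<Rightarrow> 'v set) \<Rightarrow> 'v \<times> 'v set \<Rightarrow> 'v \<times> 'v set" where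
  "face_step \<rho> d = (case d of (v, e) \<Rightarrow> let w = other_end e v in (w, \<rho> w e))"

definition faces :: "'v set set \<Rightarrow> ('v \<Rightarrow> 'v set \<Rightarrow> 'v set) \<Rightarrow> ('v \<times> 'v set) set set" where
  "faces E \<rho> = orbit (face_step \<rho>) ` darts E"

text \<open>
  The rotation system describes a 2-cell embedding in the orientable surface obtained by gluing
  an open disc along each face boundary walk. For a connected graph with at least one edge this
  surface is connected and closed, and its genus \<open>g\<close> is determined by its Euler characteristic
  \<open>2 - 2g\<close>. (The one-vertex graph has no darts, so its single face is not counted here.)
\<close>
definition two_cell_embedding ::
  "nat \<Rightarrow> 'v set \<Rightarrow> 'v set set \<Rightarrow> ('v \<Rightarrow> 'v set \<Rightarrow> 'v set) \<Rightarrow> bool" where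
  "two_cell_embedding g V E \<rho> \<longleftrightarrow>
     simple_graph V E \<and> connected_graph V E \<and> rotation_system V E \<rho> \<and>
     int (card V) - int (card E) + int (card (faces E \<rho>)) = 2 - 2 * int g"

abbreviation double_torus_embedding ::
  "'v set \<Rightarrow> 'v set set \<Rightarrow> ('v \<Rightarrow> 'v set \<Rightarrow> 'v set) \<Rightarrow> bool" where
  "double_torus_embedding \<equiv> two_cell_embedding 2"

definition graph_automorphism ::
  "'v set \<Rightarrow> 'v set set \<Rightarrow> ('v \<Rightarrow> 'v) \<Rightarrow> ('v set \<Rightarrow> 'v set) \<Rightarrow> bool" where
  "graph_automorphism V E \<pi> \<phi> \<longleftrightarrow>
     bij_betw \<pi> V V \<and> bij_betw \<phi> E E \<and>
     (\<forall>v\<in>V. \<forall>e\<in>E. v \<in> e \<longleftrightarrow> \<pi> v \<in> \<phi> e)"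

text \<open>
  Cyclic orders must be carried to cyclic orders in the same sense; a rotation system and its
  mirror image (all \<open>\<rho> v\<close> inverted) are not identified by definition.
\<close>
definition isomorphic_embeddings ::
  "'v set \<Rightarrow> 'v set set \<Rightarrow> ('v \<Rightarrow> 'v set \<Rightarrow> 'v set) \<Rightarrow> ('v \<Rightarrow> 'v set \<Rightarrow> 'v set) \<Rightarrow> bool" where
  "isomorphic_embeddings V E \<rho> \<rho>' \<longleftrightarrow>
     (\<exists>\<pi> \<phi>. graph_automorphism V E \<pi> \<phi> \<and>
        (\<forall>v\<in>V. \<forall>e\<in>incident_edges E v. \<phi> (\<rho> v e) = \<rho>' (\<pi> v) (\<phi> e)))"

end

theory Submission
  imports Defs
begin

text \<open>
  By Euler's formula an embedding of \<open>K\<^sub>3\<^sub>,\<^sub>3\<close> in the double torus has a single face. A vertex has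
  only two possible rotations, so two vertices \<open>a\<^sub>0, a\<^sub>1\<close> of one side induce the same cyclic order
  of the other side, and likewise \<open>b\<^sub>0, b\<^sub>1\<close>; after exchanging names within these pairs, \<open>a\<^sub>0, a\<^sub>1\<close>
  turn as \<open>b\<^sub>0 b\<^sub>1 b\<^sub>2\<close> and \<open>b\<^sub>0, b\<^sub>1\<close> turn as \<open>a\<^sub>0 a\<^sub>1 a\<^sub>2\<close>. Only the senses of \<open>a\<^sub>2\<close> and \<open>b\<^sub>2\<close> remain free.
  If both agree with, or both oppose, those of their companions, then there are at least two faces. If
  exactly one opposes, there is a single face of length 18, and the two such cases are exchanged by
  swapping the sides.
\<close>

section \<open>Rotations at vertices of degree three\<close>

text \<open>Edges at \<open>v\<close> are named by their far ends, so that rotations at different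
  vertices of one side become comparable as cyclic orders of the opposite side.\<close>

definition turns :: "('v \<Rightarrow> 'v set \<Rightarrow> 'v set) \<Rightarrow> 'v \<Rightarrow> 'v \<Rightarrow> 'v \<Rightarrow> 'v \<Rightarrow> bool" where
  "turns \<rho> v x y z \<longleftrightarrow> \<rho> v {v, x} = {v, y} \<and> \<rho> v {v, y} = {v, z} \<and> \<rho> v {v, z} = {v, x}"

lemma turns_rotate: "turns \<rho> v x y z \<longleftrightarrow> turns \<rho> v y z x"
  by (auto simp: turns_def)

lemma turns_determined:
  assumes "turns \<rho> v x y z" "turns \<rho> v x y' z'"
  shows "y' = y \<and> z' = z"
proof -
  have "{v, y'} = {v, y}"
    using assms by (simp add: turns_def)
  then have "y' = y"
    by (metis doubleton_eq_iff)
  moreover from this have "{v, z'} = {v, z}"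
    using assms by (simp add: turns_def)
  then have "z' = z"
    by (metis doubleton_eq_iff)
  ultimately show ?thesis ..
qed

text \<open>Iterating \<open>f\<close> rotates the list, so every entry reaches every other. This
  reduces face tracing to simplification of explicit lists, and also gives cyclicity of
  rotations.\<close>

lemma orbit_closed_list:
  assumes "map f xs = rotate1 xs" "x \<in> set xs"
  shows "orbit f x = set xs"
proof -
  let ?n = "length xs"
  have pow: "map (f ^^ k) xs = rotate k xs" for k
  proof (induction k)
    case (Suc k)
    have "map (f ^^ Suc k) xs = map f (map (f ^^ k) xs)"
      by simp
    also have "\<dots> = rotate (Suc k) xs"
      using Suc assms(1) by (simp add: rotate_map[symmetric] rotate1_rotate_swap)
    finally show ?case .
  qed simp
  obtain i where i: "i < ?n" "x = xs ! i"
    using assms(2) by (auto simp: in_set_conv_nth)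
  have nth: "(f ^^ k) x = xs ! ((k + i) mod ?n)" for k
    using i pow[of k] by (metis nth_map nth_rotate)
  have "xs ! j \<in> orbit f x" if "j < ?n" for j
  proof -
    \<comment> \<open>Going forward \<open>?n - i\<close> steps from index \<open>i\<close> returns
      to index 0. The detour keeps the exponent positive, as \<open>orbit\<close> demands.\<close>
    have "(f ^^ (j + (?n - i))) x = xs ! j"
      using that i nth by simp
    moreover have "0 < j + (?n - i)"
      using i by simp
    ultimately show ?thesis
      unfolding orbit_altdef by (metis (mono_tags, lifting) mem_Collect_eq)
  qed
  moreover have "(f ^^ k) x \<in> set xs" for k
    unfolding nth using i by (intro nth_mem mod_less_divisor) (cases xs; simp)
  ultimately show ?thesis
    by (auto simp: orbit_altdef in_set_conv_nth)
qed

text \<open>A fixed point would have a singleton orbit, so \<open>f\<close> moves all three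
  elements, and injectivity leaves only the two 3-cycles.\<close>

lemma three_cycle_cases:
  assumes "f permutes {x, y, z}" "cyclic_on f {x, y, z}" "distinct [x, y, z]"
  shows "f x = y \<and> f y = z \<and> f z = x \<or> f y = x \<and> f x = z \<and> f z = y"
proof -
  have moved: "f s \<noteq> s" if "s \<in> {x, y, z}" for s
  proof
    assume "f s = s"
    then have "orbit f s = {s}"
      using orbit_closed_list[of f "[s]" s] by simp
    moreover have "orbit f s = {x, y, z}"
      using assms(2) that unfolding cyclic_on_alldef by metis
    ultimately have "{x, y, z} = {s}"
      by simp
    then show False
      using assms(3) by auto
  qed
  have closed: "f s \<in> {x, y, z}" if "s \<in> {x, y, z}" for s
    using that permutes_in_image[OF assms(1)] by blast
  have "f x \<noteq> f y" "f y \<noteq> f z" "f z \<noteq> f x"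
    using permutes_inj[OF assms(1)] assms(3) by (auto simp: inj_eq)
  moreover have "f x \<in> {y, z}" "f y \<in> {z, x}" "f z \<in> {x, y}"
    using closed[of x] closed[of y] closed[of z] moved[of x] moved[of y] moved[of z] by blast+
  ultimately show ?thesis
    by (elim insertE emptyE) simp_all
qed

lemma turns_cases:
  assumes "rotation_system V E \<rho>" "v \<in> V" "distinct [x, y, z]"
    "incident_edges E v = {{v, x}, {v, y}, {v, z}}"
  shows "turns \<rho> v x y z \<or> turns \<rho> v y x z"
proof -
  have "\<rho> v permutes incident_edges E v"
    "incident_edges E v \<noteq> {} \<longrightarrow> cyclic_on (\<rho> v) (incident_edges E v)"
    using assms(1,2) by (simp_all add: rotation_system_def)
  then have "\<rho> v permutes {{v, x}, {v, y}, {v, z}}" "cyclic_on (\<rho> v) {{v, x}, {v, y}, {v, z}}"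
    unfolding assms(4) by simp_all
  moreover have "distinct [{v, x}, {v, y}, {v, z}]"
    using assms(3) by (auto simp: doubleton_eq_iff)
  ultimately show ?thesis
    unfolding turns_def by (rule three_cycle_cases)
qed

text \<open>Pigeonhole: two senses for three vertices. Agreement is stated for every labelling of
  \<open>B\<close>, because the final names of its elements are chosen only later.\<close>

lemma agreeing_pair:
  assumes "card A = 3" "B = {x, y, z}" "distinct [x, y, z]"
    and "\<And>v. v \<in> A \<Longrightarrow> turns \<rho> v x y z \<or> turns \<rho> v y x z"
  obtains a0 a1 a2 where "A = {a0, a1, a2}" "distinct [a0, a1, a2]"
    "\<And>b0 b1 b2. B = {b0, b1, b2} \<Longrightarrow> turns \<rho> a0 b0 b1 b2 \<Longrightarrow> turns \<rho> a1 b0 b1 b2"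
proof -
  note pair_thesis = that
  obtain p q r where A: "A = {p, q, r}" "distinct [p, q, r]"
    using assms(1) by (auto simp: card_3_iff)
  \<comment> \<open>A labelling that fits \<open>v\<close> is one of the three rotations of
    \<open>x' y' z'\<close>, determined by where \<open>b0\<close> sits, and each of these also fits
    \<open>v'\<close>.\<close>
  have agree: "turns \<rho> v' b0 b1 b2"
    if "turns \<rho> v x' y' z'" "turns \<rho> v' x' y' z'" "B = {x', y', z'}"
      "B = {b0, b1, b2}" "turns \<rho> v b0 b1 b2" for v v' x' y' z' b0 b1 b2
  proof -
    have "b0 \<in> {x', y', z'}"
      using that(3,4) by blast
    then consider "b0 = x'" | "b0 = y'" | "b0 = z'"
      by blast
    then show ?thesis
    proof cases
      case 1
      then show ?thesis
        using turns_determined[of \<rho> v x' y' z' b1 b2] that(1,2,5) by simp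
    next
      case 2
      then show ?thesis
        using turns_determined[of \<rho> v y' z' x' b1 b2] that(1,2,5) turns_rotate[of \<rho> _ x'] by simp
    next
      case 3
      then show ?thesis
        using turns_determined[of \<rho> v z' x' y' b1 b2] that(1,2,5) turns_rotate[of \<rho> _ z'] by simp
    qed
  qed
  have pair: thesis
    if A': "A = {v, v', w}" "distinct [v, v', w]"
      and same: "turns \<rho> v x y z \<and> turns \<rho> v' x y z \<or> turns \<rho> v y x z \<and> turns \<rho> v' y x z"
    for v v' w
  proof (rule pair_thesis[OF A'])
    fix b0 b1 b2
    assume b: "B = {b0, b1, b2}" "turns \<rho> v b0 b1 b2"
    have B': "B = {y, x, z}"
      using assms(2) by blast
    show "turns \<rho> v' b0 b1 b2"
      using same agree[OF _ _ assms(2) b, of v'] agree[OF _ _ B' b, of v'] by blast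
  qed
  have perms: "A = {p, r, q}" "distinct [p, r, q]" "A = {q, r, p}" "distinct [q, r, p]"
    using A by auto
  have "turns \<rho> v x y z \<or> turns \<rho> v y x z" if "v \<in> {p, q, r}" for v
    using assms(4) A(1) that by blast
  then show thesis
    using pair[OF A] pair[OF perms(1,2)] pair[OF perms(3,4)] by blast
qed

section \<open>Face boundary walks in bipartite graphs\<close>

text \<open>Edges on the left have the tail first and those on the right have \<open>w\<close>
  first, the shape produced by \<open>walk_darts\<close>; the equations therefore rewrite closed
  walks directly.\<close>

lemma face_step_turns:
  assumes "turns \<rho> w x y z" "w \<notin> {x, y, z}"
  shows "face_step \<rho> (x, {x, w}) = (w, {w, y}) \<and> face_step \<rho> (y, {y, w}) = (w, {w, z}) \<and>
    face_step \<rho> (z, {z, w}) = (w, {w, x})"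
proof -
  have "other_end {v, w} v = w" if "w \<noteq> v" for v
    using that by (simp add: other_end_def insert_Diff_if)
  then have "face_step \<rho> (v, {v, w}) = (w, \<rho> w {w, v})" if "w \<noteq> v" for v
    using that by (simp add: face_step_def insert_commute)
  then show ?thesis
    using assms by (simp add: turns_def)
qed

text \<open>The list is read cyclically: \<open>rotate1\<close> supplies the step from the last
  vertex back to the first.\<close>

definition walk_darts :: "'v list \<Rightarrow> ('v \<times> 'v set) list" where
  "walk_darts ws = map (\<lambda>(v, w). (v, {v, w})) (zip ws (rotate1 ws))"

text \<open>The complete bipartite structure with its sides exposed and their sizes left out, so
  that exchanging the sides is a symmetry.\<close>

definition bipartition :: "'v set \<Rightarrow> 'v set set \<Rightarrow> 'v set \<Rightarrow> 'v set \<Rightarrow> bool" where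
  "bipartition V E A B \<longleftrightarrow> A \<inter> B = {} \<and> V = A \<union> B \<and> E = {{a, b} | a b. a \<in> A \<and> b \<in> B}"

lemma bipartition_edges:
  "bipartition V E A B \<Longrightarrow> E = (\<lambda>(a, b). {a, b}) ` (A \<times> B)"
  by (auto simp: bipartition_def)

lemma bipartition_edge_subset: "bipartition V E A B \<Longrightarrow> e \<in> E \<Longrightarrow> e \<subseteq> V"
  by (auto simp: bipartition_def)

lemma bipartition_sym:
  assumes "bipartition V E A B"
  shows "bipartition V E B A"
proof -
  have "{{a, b} | a b. a \<in> A \<and> b \<in> B} = {{b, a} | b a. b \<in> B \<and> a \<in> A}"
    by (intro Collect_cong) (metis insert_commute)
  then show ?thesis
    using assms unfolding bipartition_def by (simp add: Int_commute Un_commute)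
qed

lemma bipartition_incident:
  assumes "bipartition V E A B" "v \<in> A"
  shows "incident_edges E v = (\<lambda>w. {v, w}) ` B"
proof
  show "incident_edges E v \<subseteq> (\<lambda>w. {v, w}) ` B"
  proof
    fix e assume "e \<in> incident_edges E v"
    then obtain a b where "e = {a, b}" "a \<in> A" "b \<in> B" "v \<in> {a, b}"
      using assms(1) by (auto simp: bipartition_def incident_edges_def)
    moreover have "v \<notin> B"
      using assms by (auto simp: bipartition_def)
    ultimately show "e \<in> (\<lambda>w. {v, w}) ` B"
      by blast
  qed
  show "(\<lambda>w. {v, w}) ` B \<subseteq> incident_edges E v"
    using assms by (auto simp: bipartition_def incident_edges_def)
qed

lemma bipartition_darts:
  assumes "bipartition V E A B"
  shows "darts E = (\<lambda>(v, w). (v, {v, w})) ` (A \<times> B \<union> B \<times> A)"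
proof -
  have "e \<subseteq> A \<union> B" if "e \<in> E" for e
    using that assms by (auto simp: bipartition_def)
  then have "darts E = (SIGMA v:A \<union> B. incident_edges E v)"
    unfolding darts_def incident_edges_def by blast
  also have "\<dots> = (SIGMA v:A. (\<lambda>w. {v, w}) ` B) \<union> (SIGMA v:B. (\<lambda>w. {v, w}) ` A)"
    unfolding Sigma_Un_distrib1
    by (intro arg_cong2[where f = "(\<union>)"] Sigma_cong refl bipartition_incident[OF assms]
        bipartition_incident[OF bipartition_sym[OF assms]])
  also have "\<dots> = (\<lambda>(v, w). (v, {v, w})) ` (A \<times> B \<union> B \<times> A)"
    by (simp add: image_Un) force
  finally show ?thesis .
qed

lemma bipartition_dartE:
  assumes "bipartition V E A B" "e \<in> incident_edges E v"
  obtains w where "e = {v, w}" "v \<in> A \<and> w \<in> B \<or> v \<in> B \<and> w \<in> A"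
proof -
  have "(v, e) \<in> darts E"
    using assms(2) by (simp add: darts_def incident_edges_def)
  then show thesis
    using that unfolding bipartition_darts[OF assms(1)] by auto
qed

lemma orbit_in_faces: "d \<in> darts E \<Longrightarrow> orbit (face_step \<rho>) d \<in> faces E \<rho>"
  by (simp add: faces_def)

section \<open>Embeddings of the complete bipartite graph\<close>

text \<open>Euler's formula reads 6 - 9 + F = -2. Simplicity and connectedness already follow from
  the graph.\<close>

lemma double_torus_iff_one_face:
  assumes "bipartition V E A B" "card A = 3" "card B = 3"
  shows "double_torus_embedding V E \<rho> \<longleftrightarrow> rotation_system V E \<rho> \<and> card (faces E \<rho>) = 1"
proof -
  have fin: "finite A" "finite B"
    using assms by (auto intro: card_ge_0_finite)
  have V: "V = A \<union> B" "A \<inter> B = {}" and E: "E = {{a, b} | a b. a \<in> A \<and> b \<in> B}"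
    using assms(1) by (auto simp: bipartition_def)
  have "card V = 6"
    using assms fin V by (simp add: card_Un_disjoint)
  moreover have "E = (\<lambda>(a, b). {a, b}) ` (A \<times> B)"
    using assms(1) by (rule bipartition_edges)
  moreover have "inj_on (\<lambda>(a, b). {a, b}) (A \<times> B)"
    using V(2) by (auto simp: inj_on_def doubleton_eq_iff)
  ultimately have cards: "card V = 6" "card E = 9"
    using assms by (simp_all add: card_image card_cartesian_product)
  have "card e = 2" if "e \<in> E" for e
    using that E V(2) by (auto simp: card_2_iff) (metis disjoint_iff)
  then have simple: "simple_graph V E"
    using fin V E by (auto simp: simple_graph_def)
  let ?R = "{(x, y). {x, y} \<in> E}"
  have AB: "(a, b) \<in> ?R" "(b, a) \<in> ?R" if "a \<in> A" "b \<in> B" for a b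
    using that E by (auto simp: insert_commute)
  obtain a b where ab: "a \<in> A" "b \<in> B"
    using assms(2,3) by (metis card.empty ex_in_conv zero_neq_numeral)
  \<comment> \<open>Any two vertices are joined through the fixed \<open>a\<close>; a vertex of
    \<open>A\<close> reaches it by way of \<open>b\<close>.\<close>
  have from_a: "(a, v) \<in> ?R\<^sup>*" and to_a: "(v, a) \<in> ?R\<^sup>*" if "v \<in> V" for v
    using that V AB ab by (blast intro: rtrancl_trans)+
  then have "connected_graph V E"
    using ab V unfolding connected_graph_def by (blast intro: rtrancl_trans)
  then show ?thesis
    using simple cards by (auto simp: two_cell_embedding_def)
qed

section \<open>The normal form and its single face\<close>

text \<open>All vertices follow the order of the labels except \<open>b2\<close>, which reverses it.
  The list records the labelling, so that two normal forms can be matched entry by entry; either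
  side of the graph may come first.\<close>

definition canonical ::
  "'v set \<Rightarrow> 'v set set \<Rightarrow> ('v \<Rightarrow> 'v set \<Rightarrow> 'v set) \<Rightarrow> 'v list \<Rightarrow> bool" where
  "canonical V E \<rho> vs \<longleftrightarrow> (\<exists>a0 a1 a2 b0 b1 b2. vs = [a0, a1, a2, b0, b1, b2] \<and>
     distinct vs \<and> bipartition V E {a0, a1, a2} {b0, b1, b2} \<and>
     turns \<rho> a0 b0 b1 b2 \<and> turns \<rho> a1 b0 b1 b2 \<and> turns \<rho> a2 b0 b1 b2 \<and>
     turns \<rho> b0 a0 a1 a2 \<and> turns \<rho> b1 a0 a1 a2 \<and> turns \<rho> b2 a1 a0 a2)"

lemma canonical_one_face:
  assumes "canonical V E \<rho> vs"
  shows "card (faces E \<rho>) = 1"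
proof -
  obtain a0 a1 a2 b0 b1 b2 where
    dist: "distinct [a0, a1, a2, b0, b1, b2]" and
    bip: "bipartition V E {a0, a1, a2} {b0, b1, b2}" and
    turns: "turns \<rho> a0 b0 b1 b2" "turns \<rho> a1 b0 b1 b2" "turns \<rho> a2 b0 b1 b2"
      "turns \<rho> b0 a0 a1 a2" "turns \<rho> b1 a0 a1 a2" "turns \<rho> b2 a1 a0 a2"
    using assms by (auto simp: canonical_def)
  \<comment> \<open>Found by tracing the face that leaves \<open>a0\<close> towards
    \<open>b0\<close>; it closes up only after all 18 darts.\<close>
  let ?ws = "[a0, b0, a1, b1, a2, b2, a1, b0, a2, b1, a0, b2, a2, b0, a0, b1, a1, b2]"
  \<comment> \<open>At the \<open>b\<close> vertices the side condition of
    \<open>face_step_turns\<close> asks for \<open>b0 \<noteq> a0\<close> and the like, the reverse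
    of the orientation to which \<open>dist\<close> unfolds.\<close>
  have "distinct [b0, b1, b2, a0, a1, a2]"
    using dist by auto
  then have closed: "map (face_step \<rho>) (walk_darts ?ws) = rotate1 (walk_darts ?ws)"
    using dist turns[THEN face_step_turns] by (simp add: walk_darts_def)
  have "set (zip ?ws (rotate1 ?ws)) =
      {a0, a1, a2} \<times> {b0, b1, b2} \<union> {b0, b1, b2} \<times> {a0, a1, a2}"
    by auto
  then have "set (walk_darts ?ws) = darts E"
    unfolding walk_darts_def bipartition_darts[OF bip] set_map by (rule arg_cong)
  then have "orbit (face_step \<rho>) d = darts E" if "d \<in> darts E" for d
    using orbit_closed_list[OF closed] that by simp
  moreover have "darts E \<noteq> {}"
    using bipartition_darts[OF bip] by simp
  ultimately have "faces E \<rho> = {darts E}"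
    by (auto simp: faces_def)
  then show ?thesis
    by simp
qed

section \<open>Reduction of one-face rotation systems to the normal form\<close>

text \<open>Each walk exhausts the orbit of any of its darts, and there is only one orbit. Two face
  walks with different darts thus refute a single face.\<close>

lemma one_face_closed_walks_eq:
  assumes "card (faces E \<rho>) = 1"
    and "map (face_step \<rho>) (walk_darts us) = rotate1 (walk_darts us)"
    and "map (face_step \<rho>) (walk_darts ws) = rotate1 (walk_darts ws)"
    and "d \<in> set (walk_darts us)" "d' \<in> set (walk_darts ws)" "d \<in> darts E" "d' \<in> darts E"
  shows "set (walk_darts us) = set (walk_darts ws)"
proof -
  have "orbit (face_step \<rho>) d = orbit (face_step \<rho>) d'"
    using assms(1) orbit_in_faces[OF assms(6)] orbit_in_faces[OF assms(7)]
    by (metis card_1_singletonE singletonD)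
  then show ?thesis
    using orbit_closed_list[OF assms(2,4)] orbit_closed_list[OF assms(3,5)] by simp
qed

lemma canonical_exists:
  assumes bip: "bipartition V E A B" and "card A = 3" "card B = 3"
    and rot: "rotation_system V E \<rho>" and face: "card (faces E \<rho>) = 1"
  obtains vs where "canonical V E \<rho> vs"
proof -
  have V: "V = A \<union> B" "A \<inter> B = {}"
    using bip by (auto simp: bipartition_def)
  have turns_A: "turns \<rho> v x y z \<or> turns \<rho> v y x z"
    if "v \<in> A" "B = {x, y, z}" "distinct [x, y, z]" for v x y z
    using turns_cases[OF rot _ that(3)] bipartition_incident[OF bip that(1)] that V by auto
  have turns_B: "turns \<rho> v x y z \<or> turns \<rho> v y x z"
    if "v \<in> B" "A = {x, y, z}" "distinct [x, y, z]" for v x y z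
    using turns_cases[OF rot _ that(3)] bipartition_incident[OF bipartition_sym[OF bip] that(1)]
      that V by auto
  obtain x y z where B': "B = {x, y, z}" "distinct [x, y, z]"
    using assms(3) by (auto simp: card_3_iff)
  obtain p0 p1 a2 where A': "A = {p0, p1, a2}" "distinct [p0, p1, a2]" and
    p: "\<And>b0 b1 b2. B = {b0, b1, b2} \<Longrightarrow> turns \<rho> p0 b0 b1 b2 \<Longrightarrow> turns \<rho> p1 b0 b1 b2"
    using agreeing_pair[OF assms(2) B' turns_A[OF _ B']] by metis
  obtain q0 q1 b2 where B'': "B = {q0, q1, b2}" "distinct [q0, q1, b2]" and
    q: "\<And>a0 a1 a2. A = {a0, a1, a2} \<Longrightarrow> turns \<rho> q0 a0 a1 a2 \<Longrightarrow> turns \<rho> q1 a0 a1 a2"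
    using agreeing_pair[OF assms(3) A' turns_B[OF _ A']] by metis
  have A'': "A = {p1, p0, a2}" and B''': "B = {q1, q0, b2}"
    using A' B'' by auto
  \<comment> \<open>\<open>p0\<close> turns as \<open>q0 q1 b2\<close> or as
    \<open>q1 q0 b2\<close>; the names within the pair are chosen to fit. The same choice on the
    other side does not interfere, since \<open>p0\<close> and \<open>p1\<close> agree.\<close>
  obtain b0 b1 where b: "B = {b0, b1, b2}" "distinct [b0, b1, b2]" "{b0, b1} = {q0, q1}"
    "turns \<rho> p0 b0 b1 b2" "turns \<rho> p1 b0 b1 b2"
    using turns_A[OF _ B'', of p0] A' B'' B''' p by (auto simp: insert_commute)
  obtain a0 a1 where a: "A = {a0, a1, a2}" "distinct [a0, a1, a2]" "{a0, a1} = {p0, p1}"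
    "turns \<rho> q0 a0 a1 a2" "turns \<rho> q1 a0 a1 a2"
    using turns_B[OF _ A', of q0] A' A'' B'' q by (auto simp: insert_commute)
  have turns: "turns \<rho> a0 b0 b1 b2" "turns \<rho> a1 b0 b1 b2"
    "turns \<rho> b0 a0 a1 a2" "turns \<rho> b1 a0 a1 a2"
    using a b by (auto simp: doubleton_eq_iff)
  have dist: "distinct [a0, a1, a2, b0, b1, b2]"
    using a b V by auto
  then have dist': "distinct [b0, b1, b2, a0, a1, a2]"
    by auto
  have bip: "bipartition V E {a0, a1, a2} {b0, b1, b2}"
    using bip a b by simp
  have darts: "(a0, {a0, b0}) \<in> darts E" "(a0, {a0, b1}) \<in> darts E" "(a0, {a0, b2}) \<in> darts E"
    by (auto simp: bipartition_darts[OF bip])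
  consider
    (same) "turns \<rho> a2 b0 b1 b2" "turns \<rho> b2 a0 a1 a2" |
    (opposite) "turns \<rho> a2 b1 b0 b2" "turns \<rho> b2 a1 a0 a2" |
    (left) "turns \<rho> a2 b0 b1 b2" "turns \<rho> b2 a1 a0 a2" |
    (right) "turns \<rho> a2 b1 b0 b2" "turns \<rho> b2 a0 a1 a2"
    using turns_A[OF _ b(1,2), of a2] turns_B[OF _ a(1,2), of b2] a(1) b(1) by auto
  then show thesis
  proof cases
    case same
    \<comment> \<open>All vertices turn alike, so a face walk advances by one on each side. The
      faces are three hexagons, two of which are traced here.\<close>
    let ?us = "[a0, b0, a1, b1, a2, b2]"
    let ?ws = "[a0, b1, a1, b2, a2, b0]"
    have "set (walk_darts ?us) = set (walk_darts ?ws)"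
      by (rule one_face_closed_walks_eq[OF face, where d = "(a0, {a0, b0})" and d' = "(a0, {a0, b1})"])
        (use dist dist' darts turns[THEN face_step_turns] same[THEN face_step_turns] in
          \<open>simp_all add: walk_darts_def\<close>)
    moreover have "(a0, {a0, b0}) \<in> set (walk_darts ?us)" "(a0, {a0, b0}) \<notin> set (walk_darts ?ws)"
      using dist by (auto simp: walk_darts_def doubleton_eq_iff)
    ultimately show thesis
      by simp
  next
    case opposite
    \<comment> \<open>The faces have lengths 10, 4 and 4; the long one and one quadrilateral are
      compared.\<close>
    let ?us = "[a0, b0, a1, b1, a2, b0, a0, b1, a1, b2]"
    let ?ws = "[a0, b2, a2, b1]"
    have "set (walk_darts ?us) = set (walk_darts ?ws)"
      by (rule one_face_closed_walks_eq[OF face, where d = "(a0, {a0, b0})" and d' = "(a0, {a0, b2})"])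
        (use dist dist' darts turns[THEN face_step_turns] opposite[THEN face_step_turns] in
          \<open>simp_all add: walk_darts_def\<close>)
    moreover have "(a0, {a0, b0}) \<in> set (walk_darts ?us)" "(a0, {a0, b0}) \<notin> set (walk_darts ?ws)"
      using dist by (auto simp: walk_darts_def doubleton_eq_iff)
    ultimately show thesis
      by simp
  next
    case left
    then have "canonical V E \<rho> [a0, a1, a2, b0, b1, b2]"
      using dist bip turns by (simp add: canonical_def)
    then show thesis ..
  next
    case right
    \<comment> \<open>Exchanging the sides puts the reversing vertex \<open>a2\<close> in the last
      place.\<close>
    then have "canonical V E \<rho> [b0, b1, b2, a0, a1, a2]"
      using dist' bipartition_sym[OF bip] turns by (simp add: canonical_def)
    then show thesis ..
  qed
qed

section \<open>Realization of the normal form\<close>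

lemma canonical_rotation_exists:
  assumes bip: "bipartition V E A B" and "card A = 3" "card B = 3"
  obtains \<rho> vs where "rotation_system V E \<rho>" "canonical V E \<rho> vs"
proof -
  obtain a0 a1 a2 where A: "A = {a0, a1, a2}" "distinct [a0, a1, a2]"
    using assms(2) by (auto simp: card_3_iff)
  obtain b0 b1 b2 where B: "B = {b0, b1, b2}" "distinct [b0, b1, b2]"
    using assms(3) by (auto simp: card_3_iff)
  have V: "V = A \<union> B" "A \<inter> B = {}"
    using bip by (auto simp: bipartition_def)
  have dist: "distinct [a0, a1, a2, b0, b1, b2]"
    using A B V by auto
  \<comment> \<open>Only \<open>b2\<close> gets a reversed list. The last branch serves
    \<open>b0\<close> and \<open>b1\<close> and is a default outside \<open>V\<close>.\<close>
  define nbrs where "nbrs v = (if v \<in> A then [b0, b1, b2] else if v = b2 then [a1, a0, a2]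
    else [a0, a1, a2])" for v
  define \<rho> where "\<rho> v = cycle_of_list (map (\<lambda>w. {v, w}) (nbrs v))" for v
  have inc: "incident_edges E v = set (map (\<lambda>w. {v, w}) (nbrs v))" if "v \<in> V" for v
  proof -
    have "set (nbrs v) = (if v \<in> A then B else A)"
      using A(1) B(1) by (auto simp: nbrs_def)
    then show ?thesis
      using that V bipartition_incident[OF bip, of v]
        bipartition_incident[OF bipartition_sym[OF bip], of v]
      by (cases "v \<in> A") simp_all
  qed
  have nbrs: "nbrs a0 = [b0, b1, b2]" "nbrs a1 = [b0, b1, b2]" "nbrs a2 = [b0, b1, b2]"
    "nbrs b0 = [a0, a1, a2]" "nbrs b1 = [a0, a1, a2]" "nbrs b2 = [a1, a0, a2]"
    using dist A(1) by (auto simp: nbrs_def)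
  have "distinct (nbrs v)" for v
    using dist by (auto simp: nbrs_def)
  moreover have "inj (\<lambda>w. {v, w})" for v :: 'a
    by (auto intro!: injI simp: doubleton_eq_iff)
  ultimately have "distinct (map (\<lambda>w. {v, w}) (nbrs v))" for v
    by (metis distinct_map inj_on_subset subset_UNIV)
  \<comment> \<open>This is the hypothesis of \<open>orbit_closed_list\<close>, hence cyclicity;
    read entry by entry, it also gives the \<open>turns\<close> equations.\<close>
  then have rotate: "map (\<rho> v) (map (\<lambda>w. {v, w}) (nbrs v)) = rotate1 (map (\<lambda>w. {v, w}) (nbrs v))"
    for v
    using cyclic_rotation[of "map (\<lambda>w. {v, w}) (nbrs v)" 1] unfolding \<rho>_def by simp
  have "rotation_system V E \<rho>"
    unfolding rotation_system_def
  proof (intro ballI conjI impI)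
    fix v assume v: "v \<in> V"
    show "\<rho> v permutes incident_edges E v"
      unfolding inc[OF v] \<rho>_def by (rule cycle_permutes)
    assume "incident_edges E v \<noteq> {}"
    then obtain e where "e \<in> incident_edges E v"
      by blast
    then show "cyclic_on (\<rho> v) (incident_edges E v)"
      using orbit_closed_list[OF rotate] unfolding inc[OF v] by (metis cyclic_on_singleI)
  qed
  moreover have "canonical V E \<rho> [a0, a1, a2, b0, b1, b2]"
    unfolding canonical_def turns_def
    using dist bip A(1) B(1) rotate[of a0] rotate[of a1] rotate[of a2] rotate[of b0] rotate[of b1]
      rotate[of b2]
    by (simp add: nbrs)
  ultimately show thesis ..
qed

section \<open>Isomorphism of any two normal forms\<close>

lemma turns_transport:
  assumes "turns \<rho> v x y z" "turns \<rho>' (\<pi> v) (\<pi> x) (\<pi> y) (\<pi> z)" "w \<in> {x, y, z}"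
  shows "\<pi> ` \<rho> v {v, w} = \<rho>' (\<pi> v) (\<pi> ` {v, w})"
  using assms by (auto simp: turns_def)

lemma bij_betw_lists:
  assumes "distinct xs" "distinct ys" "length xs = length ys"
  obtains \<pi> where "bij_betw \<pi> (set xs) (set ys)" "map \<pi> xs = ys"
proof -
  define \<pi> where "\<pi> = the \<circ> map_of (zip xs ys)"
  have map: "map \<pi> xs = ys"
    using assms by (auto simp: \<pi>_def list_eq_iff_nth_eq map_of_zip_nth)
  then have "bij_betw \<pi> (set xs) (set ys)"
    using assms by (metis bij_betw_def distinct_map set_map)
  then show thesis
    using map ..
qed

text \<open>Sending each label to its counterpart maps sides to sides, hence preserves the complete
  bipartite graph, and carries the prescribed turns to each other. The two labellings may start with
  different sides.\<close>

lemma canonical_isomorphic: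
  assumes "canonical V E \<rho> vs" "canonical V E \<rho>' vs'"
  shows "isomorphic_embeddings V E \<rho> \<rho>'"
proof -
  obtain a0 a1 a2 b0 b1 b2 where
    vs: "vs = [a0, a1, a2, b0, b1, b2]" "distinct vs" and
    bip: "bipartition V E {a0, a1, a2} {b0, b1, b2}" and
    turns: "turns \<rho> a0 b0 b1 b2" "turns \<rho> a1 b0 b1 b2" "turns \<rho> a2 b0 b1 b2"
      "turns \<rho> b0 a0 a1 a2" "turns \<rho> b1 a0 a1 a2" "turns \<rho> b2 a1 a0 a2"
    using assms(1) unfolding canonical_def by blast
  obtain c0 c1 c2 d0 d1 d2 where
    vs': "vs' = [c0, c1, c2, d0, d1, d2]" "distinct vs'" and
    bip': "bipartition V E {c0, c1, c2} {d0, d1, d2}" and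
    turns': "turns \<rho>' c0 d0 d1 d2" "turns \<rho>' c1 d0 d1 d2" "turns \<rho>' c2 d0 d1 d2"
      "turns \<rho>' d0 c0 c1 c2" "turns \<rho>' d1 c0 c1 c2" "turns \<rho>' d2 c1 c0 c2"
    using assms(2) unfolding canonical_def by blast
  have V: "V = set vs" "V = set vs'"
    using bip bip'
    by (simp_all only: bipartition_def vs(1) vs'(1) list.set Un_insert_left Un_empty_left)
  have "length vs = length vs'"
    by (simp add: vs(1) vs'(1))
  then obtain \<pi> where "bij_betw \<pi> (set vs) (set vs')" and "map \<pi> vs = vs'"
    using bij_betw_lists[OF vs(2) vs'(2)] by metis
  then have bij: "bij_betw \<pi> V V" and "map \<pi> vs = vs'"
    using V by simp_all
  then have \<pi>: "\<pi> a0 = c0" "\<pi> a1 = c1" "\<pi> a2 = c2" "\<pi> b0 = d0" "\<pi> b1 = d1" "\<pi> b2 = d2"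
    by (simp_all add: vs(1) vs'(1))
  \<comment> \<open>Applied to the first bipartition, the image consists of all edges between the
    sides of the second, which is again \<open>E\<close>.\<close>
  have "(`) \<pi> ` (\<lambda>(a, b). {a, b}) ` (A \<times> B) = (\<lambda>(a, b). {a, b}) ` (\<pi> ` A \<times> \<pi> ` B)" for A B
    by (simp add: image_paired_Times[symmetric] image_image split_beta)
  from this[of "{a0, a1, a2}" "{b0, b1, b2}"] have image: "(`) \<pi> ` E = E"
    unfolding bipartition_edges[OF bip, symmetric] image_insert image_empty \<pi>
      bipartition_edges[OF bip', symmetric] .
  have inj: "inj_on \<pi> V"
    using bij by (rule bij_betw_imp_inj_on)
  have sub: "e \<subseteq> V" if "e \<in> E" for e
    using bipartition_edge_subset[OF bip that] .
  have "inj_on ((`) \<pi>) E"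
    using inj_on_image_Pow[OF inj] by (rule inj_on_subset) (use sub in blast)
  then have "bij_betw ((`) \<pi>) E E"
    using image by (simp add: bij_betw_def)
  then have automorphism: "graph_automorphism V E \<pi> ((`) \<pi>)"
    using bij inj_on_image_mem_iff[OF inj] sub by (auto simp: graph_automorphism_def)
  note transport = turns_transport[OF turns(1) turns'(1)[folded \<pi>]]
    turns_transport[OF turns(2) turns'(2)[folded \<pi>]]
    turns_transport[OF turns(3) turns'(3)[folded \<pi>]]
    turns_transport[OF turns(4) turns'(4)[folded \<pi>]]
    turns_transport[OF turns(5) turns'(5)[folded \<pi>]]
    turns_transport[OF turns(6) turns'(6)[folded \<pi>]]
  have "\<pi> ` \<rho> v e = \<rho>' (\<pi> v) (\<pi> ` e)" if "v \<in> V" "e \<in> incident_edges E v" for v e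
  proof -
    obtain w where e: "e = {v, w}" and
      "v \<in> {a0, a1, a2} \<and> w \<in> {b0, b1, b2} \<or> v \<in> {b0, b1, b2} \<and> w \<in> {a0, a1, a2}"
      by (rule bipartition_dartE[OF bip \<open>e \<in> incident_edges E v\<close>])
    \<comment> \<open>The set for \<open>b2\<close> is listed in the order of its turn, so that
      \<open>transport\<close> matches syntactically.\<close>
    then consider "v = a0" "w \<in> {b0, b1, b2}" | "v = a1" "w \<in> {b0, b1, b2}"
      | "v = a2" "w \<in> {b0, b1, b2}" | "v = b0" "w \<in> {a0, a1, a2}" | "v = b1" "w \<in> {a0, a1, a2}"
      | "v = b2" "w \<in> {a1, a0, a2}"
      by blast
    then show ?thesis
      unfolding e by cases (simp_all only: transport)
  qed
  with automorphism show ?thesis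
    unfolding isomorphic_embeddings_def by blast
qed

theorem theorem12:
  fixes V :: "'v set" and E :: "'v set set"
  assumes "complete_bipartite 3 3 V E"
  shows "(\<exists>\<rho>. double_torus_embedding V E \<rho>) \<and>
    (\<forall>\<rho> \<rho>'. double_torus_embedding V E \<rho> \<longrightarrow> double_torus_embedding V E \<rho>' \<longrightarrow>
       isomorphic_embeddings V E \<rho> \<rho>')"
proof -
  obtain A B where bip: "bipartition V E A B" and cards: "card A = 3" "card B = 3"
    using assms by (auto simp: complete_bipartite_def bipartition_def)
  note one_face = double_torus_iff_one_face[OF bip cards]
  obtain \<rho> vs where "rotation_system V E \<rho>" "canonical V E \<rho> vs"
    using canonical_rotation_exists[OF bip cards] .
  then have "double_torus_embedding V E \<rho>"
    using one_face canonical_one_face by blast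
  moreover have "isomorphic_embeddings V E \<rho> \<rho>'"
    if "double_torus_embedding V E \<rho>" "double_torus_embedding V E \<rho>'" for \<rho> \<rho>'
    using that canonical_exists[OF bip cards] canonical_isomorphic unfolding one_face by metis
  ultimately show ?thesis
    by blast
qed

end
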